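(* Let $I\subset\mathbb R$ be an interval and let $(\gamma_h,\gamma_h^d):I\to\Delta_1$ be a spacelike Legendre curve with curvature $(m_h,n_h)$. (1) Suppose that there exists a smooth function $\varphi:I\to\mathbb R$ such that $m_h(t)\cosh\varphi(t)+n_h(t)\sinh\varphi(t)=0$ for all $t\in I$. Then (the horocyclic evolutes are defined and), for each choice of sign, on $I$, $$(\mathcal{HE}^\pm,\mathcal{DE}^\pm,\mu^\pm_{\mathcal E})^T=N_1^\mp(-\tanh\varphi)\,B_2(\varphi)\,(HE,\nu_{HE},\mu_{HE})^T .$$ (2) Suppose that there exists a smooth function $f:I\to\mathbb R$ such that $m_h(t)+f(t)n_h(t)=0$ for all $t\in I$. If $|f(t)|<1$ for all $t\in I$, then (the hyperbolic evolute is defined and), for each choice of sign, on $I$, $$(HE,\nu_{HE},\mu_{HE})^T=B_2(-\operatorname{arctanh}f)\,N_1^\mp(f)\,(\mathcal{HE}^\pm,\mathcal{DE}^\pm,\mu^\pm_{\mathcal E})^T .$$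
   Context: All maps are $C^\infty$. $\mathbb R^3_1$ is $\mathbb R^3$ with $\langle x,y\rangle=-x_1y_1+x_2y_2+x_3y_3$ and $x\wedge y=(-(x_2y_3-x_3y_2),\,x_3y_1-x_1y_3,\,x_1y_2-x_2y_1)$. $H^2=\{x:\langle x,x\rangle=-1\}$, $S^2_1=\{x:\langle x,x\rangle=1\}$, $\Delta_1=\{(v,w)\in H^2\times S_1^2:\langle v,w\rangle=0\}$. A spacelike Legendre curve in $\Delta_1$ is a smooth map $(\gamma_h,\gamma_h^d):I\to\Delta_1$ with $\langle\dot\gamma_h,\gamma_h^d\rangle=0$ on $I$. Put $\gamma_h^s=\gamma_h\wedge\gamma_h^d\in S_1^2$. Its curvature $(m_h,n_h)$ is defined by $\dot\gamma_h=m_h\gamma_h^s$, $\dot\gamma_h^d=n_h\gamma_h^s$, $\dot\gamma_h^s=m_h\gamma_h-n_h\gamma_h^d$. Standing assumption: $\{t\in I: n_h(t)\ne0\}$ is dense in $I$. Horocyclic evolutes: if there is a smooth $f:I\to\mathbb R$ with $m_h+fn_h=0$ on $I$ (it is then unique), then $\mathcal{HE}^\pm=\gamma_h+f\gamma_h^d+\frac{f^2}{2}(\gamma_h\pm\gamma_h^s)$, $\mathcal{DE}^\pm=\mp\frac{f^2}{2}\gamma_h\mp f\gamma_h^d+\left(1-\frac{f^2}{2}\right)\gamma_h^s$, and $\mu^\pm_{\mathcal E}=\mathcal{HE}^\pm\wedge\mathcal{DE}^\pm$. Hyperbolic evolute: if there is a smooth $\varphi:I\to\mathbb R$ with $m_h\cosh\varphi+n_h\sinh\varphi=0$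 on $I$ (it is then unique), then $HE=\cosh\varphi\,\gamma_h+\sinh\varphi\,\gamma_h^d$, $\nu_{HE}=\gamma_h^s$, $\mu_{HE}=HE\wedge\nu_{HE}$. Matrices: $B_2(\phi)=\begin{pmatrix}\cosh\phi&0&\sinh\phi\\0&1&0\\ \sinh\phi&0&\cosh\phi\end{pmatrix}$, $N_1^\pm(\phi)=\begin{pmatrix}1+\frac{\phi^2}{2}&\mp\frac{\phi^2}{2}&\phi\\ \pm\frac{\phi^2}{2}&1-\frac{\phi^2}{2}&\pm\phi\\ \phi&\mp\phi&1\end{pmatrix}$. For a $3\times3$ matrix $A=(a_{ij})$ and vectors $v_1,v_2,v_3$, $A(v_1,v_2,v_3)^T$ denotes the triple whose $i$-th entry is $\sum_j a_{ij}v_j$. Upper signs go together and lower signs go together. *)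

theory Defs
  imports "HOL-Analysis.Analysis"
begin

text \<open>Derivatives are taken within the set, hence one-sided at end points that belong to it.\<close>

fun Ck_on :: "nat \<Rightarrow> real set \<Rightarrow> (real \<Rightarrow> 'a::real_normed_vector) \<Rightarrow> bool" where
  "Ck_on 0 I g \<longleftrightarrow> continuous_on I g"
| "Ck_on (Suc k) I g \<longleftrightarrow>
     g differentiable_on I \<and> Ck_on k I (\<lambda>t. vector_derivative g (at t within I))"

definition smooth_on :: "real set \<Rightarrow> (real \<Rightarrow> 'a::real_normed_vector) \<Rightarrow> bool" where
  "smooth_on I g \<longleftrightarrow> (\<forall>k. Ck_on k I g)"

definition lorentz :: "real^3 \<Rightarrow> real^3 \<Rightarrow> real" where
  "lorentz x y = - (x$1 * y$1) + x$2 * y$2 + x$3 * y$3"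

definition wedge :: "real^3 \<Rightarrow> real^3 \<Rightarrow> real^3" where
  "wedge x y = vector [- (x$2 * y$3 - x$3 * y$2), x$3 * y$1 - x$1 * y$3, x$1 * y$2 - x$2 * y$1]"

text \<open>Both sheets of the hyperboloid are included.\<close>

definition H2 :: "(real^3) set" where
  "H2 = {x. lorentz x x = -1}"

definition S21 :: "(real^3) set" where
  "S21 = {x. lorentz x x = 1}"

definition Delta1 :: "((real^3) \<times> (real^3)) set" where
  "Delta1 = {(v, w). v \<in> H2 \<and> w \<in> S21 \<and> lorentz v w = 0}"

definition spacelike_legendre :: "real set \<Rightarrow> (real \<Rightarrow> real^3) \<Rightarrow> (real \<Rightarrow> real^3) \<Rightarrow> bool" where
  "spacelike_legendre I \<gamma> \<gamma>d \<longleftrightarrow>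
     smooth_on I \<gamma> \<and> smooth_on I \<gamma>d \<and>
     (\<forall>t\<in>I. (\<gamma> t, \<gamma>d t) \<in> Delta1 \<and> lorentz (vector_derivative \<gamma> (at t within I)) (\<gamma>d t) = 0)"

definition gamma_s :: "(real \<Rightarrow> real^3) \<Rightarrow> (real \<Rightarrow> real^3) \<Rightarrow> real \<Rightarrow> real^3" where
  "gamma_s \<gamma> \<gamma>d t = wedge (\<gamma> t) (\<gamma>d t)"

definition legendre_curvature ::
  "real set \<Rightarrow> (real \<Rightarrow> real^3) \<Rightarrow> (real \<Rightarrow> real^3) \<Rightarrow> (real \<Rightarrow> real) \<Rightarrow> (real \<Rightarrow> real) \<Rightarrow> bool" where
  "legendre_curvature I \<gamma> \<gamma>d m n \<longleftrightarrow>
     (\<forall>t\<in>I. (\<gamma> has_vector_derivative m t *\<^sub>R gamma_s \<gamma> \<gamma>d t) (at t within I) \<and>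
            (\<gamma>d has_vector_derivative n t *\<^sub>R gamma_s \<gamma> \<gamma>d t) (at t within I) \<and>
            (gamma_s \<gamma> \<gamma>d has_vector_derivative (m t *\<^sub>R \<gamma> t - n t *\<^sub>R \<gamma>d t)) (at t within I))"

text \<open>Every spacelike Legendre curve has a curvature, and it is unique on \<open>I\<close>:
  \<open>legendre_curvature_exists\<close> and \<open>legendre_curvature_unique\<close> below.\<close>

lemma wedge_bilinear: "bounded_bilinear wedge"
  by (intro bilinear_conv_bounded_bilinear[THEN iffD1])
     (auto simp: bilinear_def wedge_def vec_eq_iff forall_3 algebra_simps intro!: linearI)

lemma lorentz_bilinear: "bounded_bilinear lorentz"
  by (intro bilinear_conv_bounded_bilinear[THEN iffD1])
     (auto simp: bilinear_def lorentz_def algebra_simps intro!: linearI)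

lemma frame_multiple:
  assumes "(v, w) \<in> Delta1" "lorentz x v = 0" "lorentz x w = 0"
  shows "lorentz (wedge v w) (wedge v w) = 1" "x = lorentz x (wedge v w) *\<^sub>R wedge v w"
    "wedge v (wedge v w) = - w" "wedge (wedge v w) w = v"
proof -
  define a b c where abc: "a = v$1" "b = v$2" "c = v$3"
  define p q r where pqr: "p = w$1" "q = w$2" "r = w$3"
  define d e f where def: "d = x$1" "e = x$2" "f = x$3"
  have h: "-(a*a)+b*b+c*c=-1" "-(p*p)+q*q+r*r=1" "-(a*p)+b*q+c*r=0"
     "-(d*a)+e*b+f*c=0" "-(d*p)+e*q+f*r=0"
    using assms by (auto simp: Delta1_def H2_def S21_def lorentz_def abc pqr def)
  define k l m where klm: "k = - (b*r-c*q)" "l = c*p-a*r" "m = a*q-b*p"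
  have g: "-(k*k)+l*l+m*m=1" using h(1-3) unfolding klm by algebra
  have i: "d = (-(d*k)+e*l+f*m)*k" using h unfolding klm by algebra
  have j: "e = (-(d*k)+e*l+f*m)*l" using h unfolding klm by algebra
  have o: "f = (-(d*k)+e*l+f*m)*m" using h unfolding klm by algebra
  show "lorentz (wedge v w) (wedge v w) = 1"
    using g by (simp add: lorentz_def wedge_def klm abc pqr)
  show "x = lorentz x (wedge v w) *\<^sub>R wedge v w"
    using i j o unfolding vec_eq_iff forall_3
    by (simp add: lorentz_def wedge_def klm abc pqr def)
  have A: "-(b*m-c*l) = -p" "c*k-a*m = -q" "a*l-b*k = -r"
    using h(1-3) unfolding klm by algebra+
  have B: "-(l*r-m*q) = a" "m*p-k*r = b" "k*q-l*p = c"
    using h(1-3) unfolding klm by algebra+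
  show "wedge v (wedge v w) = - w"
    using A unfolding vec_eq_iff forall_3 by (simp add: wedge_def klm abc pqr)
  show "wedge (wedge v w) w = v"
    using B unfolding vec_eq_iff forall_3 by (simp add: wedge_def klm abc pqr)
qed

lemma interval_at_within_nontrivial:
  fixes I :: "real set"
  assumes "is_interval I" "interior I \<noteq> {}" "t \<in> I"
  shows "at t within I \<noteq> bot"
proof -
  have "I \<noteq> {t}" using assms(2) by auto
  hence "t islimpt I" using assms(1,3) connected_imp_perfect is_interval_connected by blast
  thus ?thesis by (simp add: trivial_limit_within)
qed

lemma lorentz_commute: "lorentz x y = lorentz y x"
  by (simp add: lorentz_def mult.commute)

lemma legendre_curvature_exists:
  assumes I: "is_interval I" "interior I \<noteq> {}" and L: "spacelike_legendre I \<gamma> \<gamma>d"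
  shows "\<exists>m n. legendre_curvature I \<gamma> \<gamma>d m n"
proof -
  let ?x = "\<lambda>t. vector_derivative \<gamma> (at t within I)" and ?s = "gamma_s \<gamma> \<gamma>d"
  let ?y = "\<lambda>t. vector_derivative \<gamma>d (at t within I)"
  let ?m = "\<lambda>t. lorentz (?x t) (?s t)" and ?n = "\<lambda>t. lorentz (?y t) (?s t)"
  have "Ck_on (Suc 0) I \<gamma>" "Ck_on (Suc 0) I \<gamma>d"
    using L unfolding spacelike_legendre_def smooth_on_def by blast+
  hence dI: "\<gamma> differentiable_on I" "\<gamma>d differentiable_on I" by simp_all
  have "(\<gamma> has_vector_derivative ?m t *\<^sub>R ?s t) (at t within I) \<and>
        (\<gamma>d has_vector_derivative ?n t *\<^sub>R ?s t) (at t within I) \<and>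
        (?s has_vector_derivative (?m t *\<^sub>R \<gamma> t - ?n t *\<^sub>R \<gamma>d t)) (at t within I)"
    if t: "t \<in> I" for t
  proof -
    have dx: "(\<gamma> has_vector_derivative ?x t) (at t within I)"
      and dy: "(\<gamma>d has_vector_derivative ?y t) (at t within I)"
      using dI t by (auto simp: differentiable_on_def vector_derivative_works)
    note nb = interval_at_within_nontrivial[OF I t]
    have const: "lorentz (g t) h' + lorentz g' (h t) = 0"
      if g: "(g has_vector_derivative g') (at t within I)" "(h has_vector_derivative h') (at t within I)"
        and c: "\<And>u. u \<in> I \<Longrightarrow> lorentz (g u) (h u) = c" for g h g' h' c
    proof -
      have "((\<lambda>u. c) has_vector_derivative lorentz (g t) h' + lorentz g' (h t)) (at t within I)"
        using bounded_bilinear.has_vector_derivative[OF lorentz_bilinear g]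
        by (rule has_vector_derivative_transform[OF t, rotated]) (simp add: c)
      thus ?thesis
        using vector_derivative_unique_within[OF nb] has_vector_derivative_const by blast
    qed
    have D: "(\<gamma> u, \<gamma>d u) \<in> Delta1" if "u \<in> I" for u
      using L that by (simp add: spacelike_legendre_def)
    have xd: "lorentz (?x t) (\<gamma>d t) = 0"
      using L t by (simp add: spacelike_legendre_def)
    have xg: "lorentz (?x t) (\<gamma> t) = 0"
      using const[OF dx dx, of "-1"] D by (simp add: Delta1_def H2_def lorentz_commute)
    have yd: "lorentz (?y t) (\<gamma>d t) = 0"
      using const[OF dy dy, of 1] D by (simp add: Delta1_def S21_def lorentz_commute)
    have yg: "lorentz (?y t) (\<gamma> t) = 0"
      using const[OF dx dy, of 0] D xd by (simp add: Delta1_def lorentz_commute)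
    have X: "?x t = ?m t *\<^sub>R ?s t" and Y: "?y t = ?n t *\<^sub>R ?s t"
      using frame_multiple(2)[OF D[OF t] xg xd] frame_multiple(2)[OF D[OF t] yg yd]
      by (simp_all add: gamma_s_def)
    have "(?s has_vector_derivative wedge (\<gamma> t) (?y t) + wedge (?x t) (\<gamma>d t)) (at t within I)"
      using bounded_bilinear.has_vector_derivative[OF wedge_bilinear dx dy]
      by (simp add: gamma_s_def[abs_def])
    also have "wedge (\<gamma> t) (?y t) + wedge (?x t) (\<gamma>d t) =
        ?n t *\<^sub>R wedge (\<gamma> t) (?s t) + ?m t *\<^sub>R wedge (?s t) (\<gamma>d t)"
      using X Y bounded_bilinear.scaleR_left[OF wedge_bilinear]
        bounded_bilinear.scaleR_right[OF wedge_bilinear] by metis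
    also have "\<dots> = ?m t *\<^sub>R \<gamma> t - ?n t *\<^sub>R \<gamma>d t"
      using frame_multiple(3,4)[OF D[OF t] xg xd] by (simp add: gamma_s_def)
    finally show ?thesis using dx dy X Y by simp
  qed
  hence "legendre_curvature I \<gamma> \<gamma>d ?m ?n" unfolding legendre_curvature_def by blast
  thus ?thesis by blast
qed

lemma legendre_curvature_unique:
  assumes I: "is_interval I" "interior I \<noteq> {}" and L: "spacelike_legendre I \<gamma> \<gamma>d"
    and C: "legendre_curvature I \<gamma> \<gamma>d m n" "legendre_curvature I \<gamma> \<gamma>d m' n'" and t: "t \<in> I"
  shows "m t = m' t \<and> n t = n' t"
proof -
  have "(\<gamma> t, \<gamma>d t) \<in> Delta1" using L t by (simp add: spacelike_legendre_def)
  hence "lorentz (gamma_s \<gamma> \<gamma>d t) (gamma_s \<gamma> \<gamma>d t) = 1"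
    using frame_multiple(1)[of "\<gamma> t" "\<gamma>d t" 0] by (simp add: gamma_s_def lorentz_def)
  hence "gamma_s \<gamma> \<gamma>d t \<noteq> 0" by (auto simp: lorentz_def)
  moreover have "m t *\<^sub>R gamma_s \<gamma> \<gamma>d t = m' t *\<^sub>R gamma_s \<gamma> \<gamma>d t"
    "n t *\<^sub>R gamma_s \<gamma> \<gamma>d t = n' t *\<^sub>R gamma_s \<gamma> \<gamma>d t"
    using C t vector_derivative_unique_within[OF interval_at_within_nontrivial[OF I t]]
    unfolding legendre_curvature_def by blast+
  ultimately show ?thesis by simp
qed

text \<open>The functions on which the evolutes depend; when \<open>n\<close> is nonzero on a dense subset of \<open>I\<close>,
  each of them is determined on \<open>I\<close> by \<open>m\<close> and \<open>n\<close>.\<close>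

definition horocyclic_fun ::
  "real set \<Rightarrow> (real \<Rightarrow> real) \<Rightarrow> (real \<Rightarrow> real) \<Rightarrow> (real \<Rightarrow> real) \<Rightarrow> bool" where
  "horocyclic_fun I m n f \<longleftrightarrow> smooth_on I f \<and> (\<forall>t\<in>I. m t + f t * n t = 0)"

definition hyperbolic_fun ::
  "real set \<Rightarrow> (real \<Rightarrow> real) \<Rightarrow> (real \<Rightarrow> real) \<Rightarrow> (real \<Rightarrow> real) \<Rightarrow> bool" where
  "hyperbolic_fun I m n \<phi> \<longleftrightarrow>
     smooth_on I \<phi> \<and> (\<forall>t\<in>I. m t * cosh (\<phi> t) + n t * sinh (\<phi> t) = 0)"

text \<open>In the following, \<open>\<sigma> \<in> {1, -1}\<close> is the choice of sign: \<open>\<plusminus>\<close> is \<open>\<sigma>\<close> and \<open>\<mp>\<close> is \<open>-\<sigma>\<close>.\<close>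

definition horo_evolute ::
  "real \<Rightarrow> (real \<Rightarrow> real^3) \<Rightarrow> (real \<Rightarrow> real^3) \<Rightarrow> (real \<Rightarrow> real) \<Rightarrow> real \<Rightarrow> real^3" where
  "horo_evolute \<sigma> \<gamma> \<gamma>d f t =
     \<gamma> t + f t *\<^sub>R \<gamma>d t + ((f t)\<^sup>2 / 2) *\<^sub>R (\<gamma> t + \<sigma> *\<^sub>R gamma_s \<gamma> \<gamma>d t)"

definition horo_evolute_dual ::
  "real \<Rightarrow> (real \<Rightarrow> real^3) \<Rightarrow> (real \<Rightarrow> real^3) \<Rightarrow> (real \<Rightarrow> real) \<Rightarrow> real \<Rightarrow> real^3" where
  "horo_evolute_dual \<sigma> \<gamma> \<gamma>d f t =
     (- \<sigma> * (f t)\<^sup>2 / 2) *\<^sub>R \<gamma> t + (- \<sigma> * f t) *\<^sub>R \<gamma>d t + (1 - (f t)\<^sup>2 / 2) *\<^sub>R gamma_s \<gamma> \<gamma>d t"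

definition horo_evolute_mu ::
  "real \<Rightarrow> (real \<Rightarrow> real^3) \<Rightarrow> (real \<Rightarrow> real^3) \<Rightarrow> (real \<Rightarrow> real) \<Rightarrow> real \<Rightarrow> real^3" where
  "horo_evolute_mu \<sigma> \<gamma> \<gamma>d f t = wedge (horo_evolute \<sigma> \<gamma> \<gamma>d f t) (horo_evolute_dual \<sigma> \<gamma> \<gamma>d f t)"

definition hyp_evolute ::
  "(real \<Rightarrow> real^3) \<Rightarrow> (real \<Rightarrow> real^3) \<Rightarrow> (real \<Rightarrow> real) \<Rightarrow> real \<Rightarrow> real^3" where
  "hyp_evolute \<gamma> \<gamma>d \<phi> t = cosh (\<phi> t) *\<^sub>R \<gamma> t + sinh (\<phi> t) *\<^sub>R \<gamma>d t"

definition hyp_evolute_nu :: "(real \<Rightarrow> real^3) \<Rightarrow> (real \<Rightarrow> real^3) \<Rightarrow> real \<Rightarrow> real^3" where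
  "hyp_evolute_nu \<gamma> \<gamma>d t = gamma_s \<gamma> \<gamma>d t"

definition hyp_evolute_mu ::
  "(real \<Rightarrow> real^3) \<Rightarrow> (real \<Rightarrow> real^3) \<Rightarrow> (real \<Rightarrow> real) \<Rightarrow> real \<Rightarrow> real^3" where
  "hyp_evolute_mu \<gamma> \<gamma>d \<phi> t = wedge (hyp_evolute \<gamma> \<gamma>d \<phi> t) (hyp_evolute_nu \<gamma> \<gamma>d t)"

text \<open>A triple of vectors is the matrix of its rows, \<open>vector [v1, v2, v3] :: real^3^3\<close>; then
  \<open>A ** vector [v1, v2, v3]\<close> is the triple with \<open>i\<close>-th entry \<open>\<Sum>j. a\<^sub>i\<^sub>j v\<^sub>j\<close>.\<close>

definition B2 :: "real \<Rightarrow> real^3^3" where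
  "B2 \<phi> = vector [vector [cosh \<phi>, 0, sinh \<phi>],
                  vector [0, 1, 0],
                  vector [sinh \<phi>, 0, cosh \<phi>]]"

definition N1 :: "real \<Rightarrow> real \<Rightarrow> real^3^3" where
  "N1 \<sigma> \<phi> = vector [vector [1 + \<phi>\<^sup>2 / 2, - \<sigma> * \<phi>\<^sup>2 / 2, \<phi>],
                    vector [\<sigma> * \<phi>\<^sup>2 / 2, 1 - \<phi>\<^sup>2 / 2, \<sigma> * \<phi>],
                    vector [\<phi>, - \<sigma> * \<phi>, 1]]"

end

theory Submission
  imports Defs
begin

text \<open>
  Write \<open>\<gamma>s\<close> for \<open>\<gamma> \<and> \<gamma>d\<close>. Both evolutes are expressed in the moving frame \<open>(\<gamma>, \<gamma>s, -\<gamma>d)\<close>, and each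
  is related to it by a matrix depending on a single parameter. The hyperbolic evolute is \<open>\<gamma>\<close> moved
  by a boost in the plane of \<open>\<gamma>\<close> and \<open>\<gamma>d\<close>, and \<open>B2 \<phi>\<close> undoes this boost
  (\<open>hyp_evolute_triple\<close>). The horocyclic evolute is \<open>\<gamma>\<close> moved along a horocycle, that is by the
  parabolic isometry \<open>N1 (-\<sigma>) (-f)\<close> (\<open>horo_evolute_triple\<close>). Composing the two gives part (1) as soon
  as \<open>f = tanh \<phi>\<close>. Part (2) follows by inverting the two factors, both being one-parameter groups:
  \<open>B2 (-\<phi>)\<close> inverts \<open>B2 \<phi>\<close> and \<open>N1 \<sigma> (-f)\<close> inverts \<open>N1 \<sigma> f\<close>.

  The defining equations \<open>m + f n = 0\<close> and \<open>m cosh \<phi> + n sinh \<phi> = 0\<close> say the same thing about \<open>f\<close> and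
  \<open>tanh \<phi>\<close>, because \<open>cosh \<phi>\<close> never vanishes. This yields the existence claims with \<open>f = tanh \<phi>\<close> and
  \<open>\<phi> = artanh f\<close>. It also yields \<open>f = tanh \<phi>\<close> for any given pair, because a solution \<open>f\<close> is
  unique: it is \<open>- m / n\<close> where \<open>n \<noteq> 0\<close>, and density and continuity determine it on all of \<open>I\<close>
  (\<open>horocyclic_fun_unique\<close>).

  What remains is the smoothness of \<open>tanh \<phi>\<close> and \<open>artanh f\<close> in the recursive sense of \<open>Ck_on\<close>. Instead
  of a chain rule of arbitrary order, the proof uses first-order differential equations: the derivatives
  of \<open>g = tanh \<phi>\<close> and of a reciprocal \<open>g = 1 / h\<close> are \<open>(1 - g\<^sup>2) \<phi>'\<close> and \<open>- g\<^sup>2 h'\<close>, so that regularity of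
  \<open>g\<close> bootstraps (\<open>smooth_on_bootstrap\<close>). The derivative of \<open>artanh f\<close> is then the smooth function
  \<open>f' / (1 - f\<^sup>2)\<close>.
\<close>

section \<open>Smooth functions on a set without isolated points\<close>

lemma Ck_on_SucE:
  assumes "Ck_on (Suc k) I g"
  obtains g' where "\<And>t. t \<in> I \<Longrightarrow> (g has_vector_derivative g' t) (at t within I)" "Ck_on k I g'"
proof (rule that)
  show "(g has_vector_derivative vector_derivative g (at t within I)) (at t within I)" if "t \<in> I" for t
    using assms that by (simp add: differentiable_on_def vector_derivative_works)
  show "Ck_on k I (\<lambda>t. vector_derivative g (at t within I))"
    using assms by simp
qed

lemma Ck_on_Suc_imp: "Ck_on (Suc k) I g \<Longrightarrow> Ck_on k I g"
  by (induction k arbitrary: g) (auto intro: differentiable_imp_continuous_on)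

lemma smooth_onE:
  assumes "smooth_on I g"
  obtains g' where "\<And>t. t \<in> I \<Longrightarrow> (g has_real_derivative g' t) (at t within I)" "smooth_on I g'"
proof
  let ?g' = "\<lambda>t. vector_derivative g (at t within I)"
  have C: "Ck_on (Suc k) I g" for k
    using assms unfolding smooth_on_def by blast
  show "(g has_real_derivative ?g' t) (at t within I)" if "t \<in> I" for t
    using C[of 0] that
    by (simp add: differentiable_on_def vector_derivative_works has_real_derivative_iff_has_vector_derivative)
  show "smooth_on I ?g'" using C by (simp add: smooth_on_def)
qed

text \<open>Without isolated points, \<open>vector_derivative\<close> within \<open>I\<close> is the derivative and not an arbitrary
  choice among several, so that regularity can be read off from a known derivative.\<close>

context
  fixes I :: "real set"
  assumes nontrivial: "\<And>t. t \<in> I \<Longrightarrow> at t within I \<noteq> bot"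
begin

lemma Ck_on_cong:
  assumes "\<And>t. t \<in> I \<Longrightarrow> f t = g t" "Ck_on k I f"
  shows "Ck_on k I g"
  using assms
proof (induction k arbitrary: f g)
  case 0
  then show ?case by (auto cong: continuous_on_cong)
next
  case (Suc k)
  have der: "(g has_vector_derivative vector_derivative f (at t within I)) (at t within I)"
    if "t \<in> I" for t
  proof -
    have "(f has_vector_derivative vector_derivative f (at t within I)) (at t within I)"
      using Suc.prems(2) that by (auto simp: differentiable_on_def vector_derivative_works)
    thus ?thesis
      by (rule has_vector_derivative_transform[OF that, rotated]) (simp add: Suc.prems(1))
  qed
  hence "vector_derivative f (at t within I) = vector_derivative g (at t within I)" if "t \<in> I" for t
    using vector_derivative_within[OF nontrivial[OF that]] that by metis
  moreover have "g differentiable_on I"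
    using der by (auto simp: differentiable_on_def intro: differentiableI_vector)
  ultimately show ?case
    using Suc.IH[of "\<lambda>t. vector_derivative f (at t within I)"] Suc.prems(2) by simp
qed

lemma Ck_on_SucI:
  assumes der: "\<And>t. t \<in> I \<Longrightarrow> (g has_vector_derivative g' t) (at t within I)"
    and "Ck_on k I g'"
  shows "Ck_on (Suc k) I g"
proof -
  have "g' t = vector_derivative g (at t within I)" if "t \<in> I" for t
    using vector_derivative_within[OF nontrivial[OF that] der[OF that]] by simp
  moreover have "g differentiable_on I"
    using der by (auto simp: differentiable_on_def intro: differentiableI_vector)
  ultimately show ?thesis using Ck_on_cong[of g'] assms(2) by simp
qed

lemma Ck_on_const: "Ck_on k I (\<lambda>t. c)"
proof (induction k arbitrary: c)
  case (Suc k)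
  show ?case by (rule Ck_on_SucI[OF has_vector_derivative_const Suc])
qed simp

lemma Ck_on_add:
  assumes "Ck_on k I f" "Ck_on k I g"
  shows "Ck_on k I (\<lambda>t. f t + g t)"
  using assms
proof (induction k arbitrary: f g)
  case (Suc k)
  obtain f' g' where
    "\<And>t. t \<in> I \<Longrightarrow> (f has_vector_derivative f' t) (at t within I)" "Ck_on k I f'"
    "\<And>t. t \<in> I \<Longrightarrow> (g has_vector_derivative g' t) (at t within I)" "Ck_on k I g'"
    using Suc.prems by (metis Ck_on_SucE)
  thus ?case
    using Suc.IH by (intro Ck_on_SucI[where g' = "\<lambda>t. f' t + g' t"] has_vector_derivative_add)
qed (auto intro: continuous_intros)

lemma Ck_on_mult:
  fixes f g :: "real \<Rightarrow> real"
  assumes "Ck_on k I f" "Ck_on k I g"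
  shows "Ck_on k I (\<lambda>t. f t * g t)"
  using assms
proof (induction k arbitrary: f g)
  case (Suc k)
  obtain f' g' where
    "\<And>t. t \<in> I \<Longrightarrow> (f has_vector_derivative f' t) (at t within I)" "Ck_on k I f'"
    "\<And>t. t \<in> I \<Longrightarrow> (g has_vector_derivative g' t) (at t within I)" "Ck_on k I g'"
    using Suc.prems by (metis Ck_on_SucE)
  moreover have "Ck_on k I f" "Ck_on k I g"
    using Suc.prems Ck_on_Suc_imp by blast+
  ultimately show ?case
    using Suc.IH
    by (intro Ck_on_SucI[where g' = "\<lambda>t. f t * g' t + f' t * g t"] has_vector_derivative_mult Ck_on_add)
qed (auto intro: continuous_intros)

lemma Ck_on_one_minus_square:
  fixes f :: "real \<Rightarrow> real"
  assumes "Ck_on k I f"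
  shows "Ck_on k I (\<lambda>t. 1 - (f t)\<^sup>2)"
  using Ck_on_add[OF Ck_on_const[of k 1] Ck_on_mult[OF Ck_on_const[of k "-1"] Ck_on_mult[OF assms assms]]]
  by (simp add: power2_eq_square)

text \<open>This replaces a chain rule of arbitrary order: if \<open>g' = d\<close>, where \<open>d\<close> is built from \<open>g\<close> and
  smooth functions, then each degree of regularity of \<open>g\<close> passes to \<open>g'\<close> and thus yields the next.\<close>

lemma smooth_on_bootstrap:
  assumes der: "\<And>t. t \<in> I \<Longrightarrow> (g has_real_derivative d t) (at t within I)"
    and step: "\<And>k. Ck_on k I g \<Longrightarrow> Ck_on k I d"
  shows "smooth_on I g"
proof -
  have "Ck_on k I g" for k
  proof (induction k)
    case 0
    show ?case using der by (auto intro: DERIV_continuous_on)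
  next
    case (Suc k)
    show ?case
      using der step[OF Suc]
      by (intro Ck_on_SucI) (auto simp: has_real_derivative_iff_has_vector_derivative)
  qed
  thus ?thesis by (simp add: smooth_on_def)
qed

lemma smooth_on_tanh:
  fixes \<phi> :: "real \<Rightarrow> real"
  assumes "smooth_on I \<phi>"
  shows "smooth_on I (\<lambda>t. tanh (\<phi> t))"
proof -
  obtain \<phi>' where der: "\<And>t. t \<in> I \<Longrightarrow> (\<phi> has_real_derivative \<phi>' t) (at t within I)"
    and sm: "smooth_on I \<phi>'"
    using smooth_onE[OF assms] by blast
  show ?thesis
  proof (rule smooth_on_bootstrap)
    show "((\<lambda>t. tanh (\<phi> t)) has_real_derivative (1 - (tanh (\<phi> t))\<^sup>2) * \<phi>' t) (at t within I)"
      if "t \<in> I" for t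
      using der[OF that] by (auto intro!: derivative_eq_intros)
    show "Ck_on k I (\<lambda>t. (1 - (tanh (\<phi> t))\<^sup>2) * \<phi>' t)" if "Ck_on k I (\<lambda>t. tanh (\<phi> t))" for k
      using that sm by (intro Ck_on_mult Ck_on_one_minus_square) (simp_all add: smooth_on_def)
  qed
qed

lemma smooth_on_inverse:
  fixes g :: "real \<Rightarrow> real"
  assumes "smooth_on I g" and nz: "\<And>t. t \<in> I \<Longrightarrow> g t \<noteq> 0"
  shows "smooth_on I (\<lambda>t. inverse (g t))"
proof -
  obtain g' where der: "\<And>t. t \<in> I \<Longrightarrow> (g has_real_derivative g' t) (at t within I)"
    and sm: "smooth_on I g'"
    using smooth_onE[OF assms(1)] by blast
  show ?thesis
  proof (rule smooth_on_bootstrap)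
    show "((\<lambda>t. inverse (g t)) has_real_derivative - 1 * g' t * (inverse (g t) * inverse (g t)))
        (at t within I)" if "t \<in> I" for t
      using der[OF that] nz[OF that] by (auto intro!: derivative_eq_intros)
    show "Ck_on k I (\<lambda>t. - 1 * g' t * (inverse (g t) * inverse (g t)))"
      if "Ck_on k I (\<lambda>t. inverse (g t))" for k
      using that sm by (intro Ck_on_mult Ck_on_const) (simp_all add: smooth_on_def)
  qed
qed

lemma smooth_on_artanh:
  fixes f :: "real \<Rightarrow> real"
  assumes "smooth_on I f" and lt: "\<And>t. t \<in> I \<Longrightarrow> \<bar>f t\<bar> < 1"
  shows "smooth_on I (\<lambda>t. artanh (f t))"
proof -
  obtain f' where der: "\<And>t. t \<in> I \<Longrightarrow> (f has_real_derivative f' t) (at t within I)"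
    and sm: "smooth_on I f'"
    using smooth_onE[OF assms(1)] by blast
  have "smooth_on I (\<lambda>t. 1 - (f t)\<^sup>2)"
    using assms(1) Ck_on_one_minus_square by (simp add: smooth_on_def)
  moreover have "1 - (f t)\<^sup>2 \<noteq> 0" if "t \<in> I" for t
    using lt[OF that] abs_square_less_1[of "f t"] by simp
  ultimately have inv: "smooth_on I (\<lambda>t. inverse (1 - (f t)\<^sup>2))"
    using smooth_on_inverse by blast
  show ?thesis
  proof (rule smooth_on_bootstrap)
    show "((\<lambda>t. artanh (f t)) has_real_derivative f' t * inverse (1 - (f t)\<^sup>2)) (at t within I)"
      if "t \<in> I" for t
      using DERIV_chain2[OF artanh_real_has_field_derivative[OF lt[OF that]] der[OF that]]
      by (simp add: divide_inverse mult.commute)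
    show "Ck_on k I (\<lambda>t. f' t * inverse (1 - (f t)\<^sup>2))" for k
      using sm inv by (intro Ck_on_mult) (simp_all add: smooth_on_def)
  qed
qed

end

section \<open>The two parameter functions\<close>

lemma tanh_artanh_real:
  fixes x :: real
  assumes "\<bar>x\<bar> < 1"
  shows "tanh (artanh x) = x"
proof -
  have "0 < (1 + x) / (1 - x)"
    using assms by (simp add: abs_less_iff)
  hence "exp (- 2 * artanh x) = (1 - x) / (1 + x)"
    by (simp add: artanh_def exp_minus)
  hence "tanh (artanh x) = (1 - (1 - x) / (1 + x)) / (1 + (1 - x) / (1 + x))"
    by (simp only: tanh_real_altdef)
  also have "\<dots> = x"
    using assms by (simp add: abs_less_iff field_simps)
  finally show ?thesis .
qed

lemma horocyclic_fun_tanh: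
  assumes nontrivial: "\<And>t. t \<in> I \<Longrightarrow> at t within I \<noteq> bot" and "hyperbolic_fun I m n \<phi>"
  shows "horocyclic_fun I m n (\<lambda>t. tanh (\<phi> t))"
proof -
  have "m t + tanh (\<phi> t) * n t = 0" if "t \<in> I" for t
  proof -
    have "m t * cosh (\<phi> t) + n t * sinh (\<phi> t) = 0"
      using assms(2) that by (simp add: hyperbolic_fun_def)
    moreover have "cosh (\<phi> t) > 0"
      by simp
    ultimately show ?thesis
      by (simp add: tanh_def field_simps)
  qed
  thus ?thesis
    using assms(2) smooth_on_tanh[OF nontrivial] by (simp add: horocyclic_fun_def hyperbolic_fun_def)
qed

lemma hyperbolic_fun_artanh:
  assumes nontrivial: "\<And>t. t \<in> I \<Longrightarrow> at t within I \<noteq> bot"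
    and horo: "horocyclic_fun I m n f" and lt: "\<And>t. t \<in> I \<Longrightarrow> \<bar>f t\<bar> < 1"
  shows "hyperbolic_fun I m n (\<lambda>t. artanh (f t))"
proof -
  have "m t * cosh (artanh (f t)) + n t * sinh (artanh (f t)) = 0" if "t \<in> I" for t
  proof -
    have "sinh (artanh (f t)) = f t * cosh (artanh (f t))"
      using tanh_artanh_real[OF lt[OF that]] by (simp add: tanh_def field_simps)
    moreover have "m t + f t * n t = 0"
      using horo that by (simp add: horocyclic_fun_def)
    ultimately show ?thesis by algebra
  qed
  thus ?thesis
    using smooth_on_artanh[OF nontrivial] horo lt by (simp add: horocyclic_fun_def hyperbolic_fun_def)
qed

text \<open>Where \<open>n \<noteq> 0\<close> the value is forced to be \<open>- m / n\<close>. The equation says nothing about \<open>f\<close> at the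
  zeros of \<open>n\<close>; there the value is a limit of values at points with \<open>n \<noteq> 0\<close>.\<close>

lemma horocyclic_fun_unique:
  assumes dense: "I \<subseteq> closure {t \<in> I. n t \<noteq> 0}"
    and f: "horocyclic_fun I m n f" and g: "horocyclic_fun I m n g" and "t \<in> I"
  shows "f t = g t"
proof -
  have "Ck_on 0 I f" "Ck_on 0 I g"
    using f g unfolding horocyclic_fun_def smooth_on_def by blast+
  hence "continuous_on I (\<lambda>u. f u - g u)"
    by (auto intro: continuous_intros)
  hence "closedin (top_of_set I) {u \<in> I. f u - g u = 0}"
    by (rule continuous_closedin_preimage_constant)
  then obtain C where C: "closed C" "{u \<in> I. f u - g u = 0} = I \<inter> C"
    by (auto simp: closedin_closed)
  have "f u = g u" if "u \<in> I" "n u \<noteq> 0" for u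
  proof -
    have "m u + f u * n u = 0" "m u + g u * n u = 0"
      using f g that by (simp_all add: horocyclic_fun_def)
    thus ?thesis using that(2) by (metis add_left_cancel mult_right_cancel)
  qed
  hence "{u \<in> I. n u \<noteq> 0} \<subseteq> C" using C(2) by auto
  hence "I \<subseteq> C" using dense C(1) closure_minimal by blast
  thus ?thesis using C(2) \<open>t \<in> I\<close> by auto
qed

section \<open>The evolutes in the moving frame\<close>

lemma B2_inverse: "B2 (- \<phi>) ** B2 \<phi> = mat 1"
  using hyperbolic_pythagoras[of \<phi>]
  by (simp add: vec_eq_iff forall_3 B2_def matrix_matrix_mult_def sum_3 mat_def power2_eq_square
      mult.commute)

lemma N1_inverse:
  assumes "\<sigma>\<^sup>2 = 1"
  shows "N1 \<sigma> f ** N1 \<sigma> (- f) = mat 1"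
proof -
  have sq: "\<sigma> * \<sigma> = 1" "\<And>x. \<sigma> * (\<sigma> * x) = x"
    using assms by (simp_all add: power2_eq_square flip: mult.assoc)
  show ?thesis
    by (simp add: vec_eq_iff forall_3 N1_def matrix_matrix_mult_def sum_3 mat_def
        power2_eq_square field_simps sq)
qed

lemma wedge_frame:
  assumes "(v, w) \<in> Delta1"
  shows "wedge v (wedge v w) = - w" "wedge w (wedge v w) = - v"
proof -
  have z: "lorentz 0 v = 0" "lorentz 0 w = 0" by (simp_all add: lorentz_def)
  show "wedge v (wedge v w) = - w" by (rule frame_multiple(3)[OF assms z])
  have "wedge w (wedge v w) = - wedge (wedge v w) w"
    by (simp add: wedge_def vec_eq_iff forall_3 algebra_simps)
  thus "wedge w (wedge v w) = - v" using frame_multiple(4)[OF assms z] by simp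
qed

text \<open>The wedge product in coordinates with respect to the frame \<open>(v, w, v \<and> w)\<close>. It turns the
  wedge products that define \<open>\<mu>\<close> for either evolute into computations with scalar coefficients.\<close>

lemma wedge_frame_combination:
  assumes "(v, w) \<in> Delta1" and s: "s = wedge v w"
  shows "wedge (a *\<^sub>R v + b *\<^sub>R w + c *\<^sub>R s) (a' *\<^sub>R v + b' *\<^sub>R w + c' *\<^sub>R s) =
    (c * b' - b * c') *\<^sub>R v + (c * a' - a * c') *\<^sub>R w + (a * b' - b * a') *\<^sub>R s"
proof -
  have "wedge (a *\<^sub>R v + b *\<^sub>R w + c *\<^sub>R s) (a' *\<^sub>R v + b' *\<^sub>R w + c' *\<^sub>R s) =
    (b * c' - c * b') *\<^sub>R wedge w s + (a * c' - c * a') *\<^sub>R wedge v s + (a * b' - b * a') *\<^sub>R wedge v w"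
    by (simp add: wedge_def vec_eq_iff forall_3 algebra_simps)
  also have "\<dots> = (c * b' - b * c') *\<^sub>R v + (c * a' - a * c') *\<^sub>R w + (a * b' - b * a') *\<^sub>R s"
    using wedge_frame[OF assms(1)] by (simp add: s algebra_simps)
  finally show ?thesis .
qed

text \<open>In the frame, \<open>HE\<close> and \<open>\<mu>\<close> are \<open>cosh \<phi> \<gamma> + sinh \<phi> \<gamma>d\<close> and \<open>- sinh \<phi> \<gamma> - cosh \<phi> \<gamma>d\<close>: the boost with
  parameter \<open>-\<phi>\<close> applied to \<open>\<gamma>\<close> and \<open>-\<gamma>d\<close>. Hence \<open>B2 \<phi>\<close> brings back the frame.\<close>

lemma hyp_evolute_triple:
  assumes D: "(\<gamma> t, \<gamma>d t) \<in> Delta1"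
  shows "B2 (\<phi> t) ** vector [hyp_evolute \<gamma> \<gamma>d \<phi> t, hyp_evolute_nu \<gamma> \<gamma>d t, hyp_evolute_mu \<gamma> \<gamma>d \<phi> t] =
    (vector [\<gamma> t, gamma_s \<gamma> \<gamma>d t, - \<gamma>d t] :: real^3^3)"
proof -
  define s where "s = gamma_s \<gamma> \<gamma>d t"
  have mu: "hyp_evolute_mu \<gamma> \<gamma>d \<phi> t = (- sinh (\<phi> t)) *\<^sub>R \<gamma> t + (- cosh (\<phi> t)) *\<^sub>R \<gamma>d t"
    using wedge_frame_combination[OF D s_def[unfolded gamma_s_def],
        of "cosh (\<phi> t)" "sinh (\<phi> t)" 0 0 0 1]
    by (simp add: hyp_evolute_mu_def hyp_evolute_def hyp_evolute_nu_def s_def)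
  show ?thesis
    unfolding mu
    by (simp add: vec_eq_iff forall_3 B2_def matrix_matrix_mult_def sum_3 hyp_evolute_def
        hyp_evolute_nu_def; insert hyperbolic_pythagoras[of "\<phi> t"]; algebra)
qed

text \<open>For the first two rows this only rewrites the definitions of the horocyclic evolute and its
  dual. The wedge product gives \<open>\<mu> = - f \<gamma> - \<gamma>d - \<sigma> f \<gamma>s\<close>, which is the third row.\<close>

lemma horo_evolute_triple:
  assumes D: "(\<gamma> t, \<gamma>d t) \<in> Delta1" and \<sigma>: "\<sigma>\<^sup>2 = 1"
  shows "(vector [horo_evolute \<sigma> \<gamma> \<gamma>d f t, horo_evolute_dual \<sigma> \<gamma> \<gamma>d f t,
      horo_evolute_mu \<sigma> \<gamma> \<gamma>d f t] :: real^3^3) =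
    N1 (- \<sigma>) (- f t) ** vector [\<gamma> t, gamma_s \<gamma> \<gamma>d t, - \<gamma>d t]"
proof -
  define s where "s = gamma_s \<gamma> \<gamma>d t"
  have E: "horo_evolute \<sigma> \<gamma> \<gamma>d f t =
      (1 + (f t)\<^sup>2 / 2) *\<^sub>R \<gamma> t + f t *\<^sub>R \<gamma>d t + (\<sigma> * (f t)\<^sup>2 / 2) *\<^sub>R s"
    by (simp add: horo_evolute_def s_def algebra_simps)
  have DE: "horo_evolute_dual \<sigma> \<gamma> \<gamma>d f t =
      (- \<sigma> * (f t)\<^sup>2 / 2) *\<^sub>R \<gamma> t + (- \<sigma> * f t) *\<^sub>R \<gamma>d t + (1 - (f t)\<^sup>2 / 2) *\<^sub>R s"
    by (simp add: horo_evolute_dual_def s_def)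
  have mu: "horo_evolute_mu \<sigma> \<gamma> \<gamma>d f t = (- f t) *\<^sub>R \<gamma> t + (- 1) *\<^sub>R \<gamma>d t + (- \<sigma> * f t) *\<^sub>R s"
  proof -
    have "\<sigma> * (f t)\<^sup>2 / 2 * (- \<sigma> * f t) - f t * (1 - (f t)\<^sup>2 / 2) = - f t"
      "\<sigma> * (f t)\<^sup>2 / 2 * (- \<sigma> * (f t)\<^sup>2 / 2) - (1 + (f t)\<^sup>2 / 2) * (1 - (f t)\<^sup>2 / 2) = - 1"
      "(1 + (f t)\<^sup>2 / 2) * (- \<sigma> * f t) - f t * (- \<sigma> * (f t)\<^sup>2 / 2) = - \<sigma> * f t"
      using \<sigma> by (simp_all add: field_simps; algebra)+
    thus ?thesis
      unfolding horo_evolute_mu_def E DE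
      by (subst wedge_frame_combination[OF D s_def[unfolded gamma_s_def]]) (simp only:)
  qed
  show ?thesis
    unfolding mu E DE s_def[symmetric]
    by (simp add: vec_eq_iff forall_3 N1_def matrix_matrix_mult_def sum_3)
qed

text \<open>The relation \<open>f = tanh \<phi>\<close> at a single point suffices, so the matrix identities involve no calculus.
  Passing through the frame gives the first one; cancelling \<open>N1\<close> and then \<open>B2\<close> gives the second.\<close>

lemma evolute_triples:
  assumes D: "(\<gamma> t, \<gamma>d t) \<in> Delta1" and \<sigma>: "\<sigma>\<^sup>2 = 1" and f: "f t = tanh (\<phi> t)"
  defines "horo \<equiv> (vector [horo_evolute \<sigma> \<gamma> \<gamma>d f t, horo_evolute_dual \<sigma> \<gamma> \<gamma>d f t,
      horo_evolute_mu \<sigma> \<gamma> \<gamma>d f t] :: real^3^3)"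
    and "hyp \<equiv> (vector [hyp_evolute \<gamma> \<gamma>d \<phi> t, hyp_evolute_nu \<gamma> \<gamma>d t,
      hyp_evolute_mu \<gamma> \<gamma>d \<phi> t] :: real^3^3)"
  shows "horo = N1 (- \<sigma>) (- tanh (\<phi> t)) ** B2 (\<phi> t) ** hyp"
    and "hyp = B2 (- artanh (f t)) ** N1 (- \<sigma>) (f t) ** horo"
proof -
  show horo: "horo = N1 (- \<sigma>) (- tanh (\<phi> t)) ** B2 (\<phi> t) ** hyp"
    unfolding horo_def hyp_def horo_evolute_triple[of \<gamma> t \<gamma>d \<sigma> f, OF D \<sigma>] f
      matrix_mul_assoc[symmetric] hyp_evolute_triple[of \<gamma> t \<gamma>d \<phi>, OF D] ..
  have "B2 (- artanh (f t)) ** N1 (- \<sigma>) (f t) ** horo =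
      B2 (- \<phi> t) ** (N1 (- \<sigma>) (f t) ** N1 (- \<sigma>) (- f t)) ** B2 (\<phi> t) ** hyp"
    unfolding horo f by (simp add: artanh_tanh_real matrix_mul_assoc)
  also have "\<dots> = hyp"
    using \<sigma> by (simp add: N1_inverse B2_inverse)
  finally show "hyp = B2 (- artanh (f t)) ** N1 (- \<sigma>) (f t) ** horo" ..
qed

theorem theorem3p9:
  fixes I :: "real set" and \<gamma> \<gamma>d :: "real \<Rightarrow> real^3" and m n :: "real \<Rightarrow> real"
  assumes "is_interval I" and "interior I \<noteq> {}"
    and "spacelike_legendre I \<gamma> \<gamma>d"
    and "legendre_curvature I \<gamma> \<gamma>d m n"
    and "I \<subseteq> closure {t \<in> I. n t \<noteq> 0}"
  shows "(\<forall>\<phi>. hyperbolic_fun I m n \<phi> \<longrightarrow>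
            (\<exists>f. horocyclic_fun I m n f) \<and>
            (\<forall>f. horocyclic_fun I m n f \<longrightarrow>
              (\<forall>\<sigma>\<in>{1, -1}. \<forall>t\<in>I.
                (vector [horo_evolute \<sigma> \<gamma> \<gamma>d f t, horo_evolute_dual \<sigma> \<gamma> \<gamma>d f t,
                         horo_evolute_mu \<sigma> \<gamma> \<gamma>d f t] :: real^3^3) =
                N1 (- \<sigma>) (- tanh (\<phi> t)) ** B2 (\<phi> t) **
                vector [hyp_evolute \<gamma> \<gamma>d \<phi> t, hyp_evolute_nu \<gamma> \<gamma>d t,
                        hyp_evolute_mu \<gamma> \<gamma>d \<phi> t])))
       \<and> (\<forall>f. horocyclic_fun I m n f \<and> (\<forall>t\<in>I. \<bar>f t\<bar> < 1) \<longrightarrow>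
            (\<exists>\<phi>. hyperbolic_fun I m n \<phi>) \<and>
            (\<forall>\<phi>. hyperbolic_fun I m n \<phi> \<longrightarrow>
              (\<forall>\<sigma>\<in>{1, -1}. \<forall>t\<in>I.
                (vector [hyp_evolute \<gamma> \<gamma>d \<phi> t, hyp_evolute_nu \<gamma> \<gamma>d t,
                         hyp_evolute_mu \<gamma> \<gamma>d \<phi> t] :: real^3^3) =
                B2 (- artanh (f t)) ** N1 (- \<sigma>) (f t) **
                vector [horo_evolute \<sigma> \<gamma> \<gamma>d f t, horo_evolute_dual \<sigma> \<gamma> \<gamma>d f t,
                        horo_evolute_mu \<sigma> \<gamma> \<gamma>d f t])))"
proof -
  have nontriv: "at t within I \<noteq> bot" if "t \<in> I" for t
    using interval_at_within_nontrivial[OF assms(1,2) that] .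
  have D: "(\<gamma> t, \<gamma>d t) \<in> Delta1" if "t \<in> I" for t
    using assms(3) that by (simp add: spacelike_legendre_def)
  have tanh: "f t = tanh (\<phi> t)"
    if "hyperbolic_fun I m n \<phi>" "horocyclic_fun I m n f" "t \<in> I" for f \<phi> t
    using horocyclic_fun_unique[OF assms(5) that(2) horocyclic_fun_tanh[OF nontriv that(1)] that(3)] .
  have sq: "\<sigma>\<^sup>2 = 1" if "\<sigma> \<in> {1, -1}" for \<sigma> :: real
    using that by auto
  show ?thesis
  proof (intro conjI allI impI ballI; (elim conjE)?)
    fix \<phi> assume "hyperbolic_fun I m n \<phi>"
    thus "\<exists>f. horocyclic_fun I m n f"
      using horocyclic_fun_tanh[OF nontriv] by blast
  next
    fix f assume "horocyclic_fun I m n f" "\<forall>t\<in>I. \<bar>f t\<bar> < 1"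
    thus "\<exists>\<phi>. hyperbolic_fun I m n \<phi>"
      using hyperbolic_fun_artanh[OF nontriv] by blast
  qed (rule evolute_triples[OF D sq tanh]; assumption)+
qed

end
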